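(* Let $G=(V,E)$ be a connected simple graph with $|V|>2$, let $k>2$ be an integer, and for integers $1\le s\le\frac{k}{2}$ let $\mathscr{B}^{k,s}$ be the quotient tensor of $\mathscr{Q}^{k,s}$. Then $\lambda(\mathscr{B}^{k,s})=\lambda(\mathscr{Q}^{k,s})$, and for fixed $k$ this common value is strictly increasing with respect to $s$ on $1\le s\le\frac{k}{2}$.
   Context: Generalized power hypergraph: for a simple graph $G=(V,E)$, an integer $k\ge2$ and $1\le s\le k/2$, $G^{k,s}$ is the $k$-uniform hypergraph obtained by taking, for each $v\in V$, a set $V_v$ of $s$ new vertices and, for each $e\in E$, a set $V_e$ of $k-2s$ new vertices (all pairwise disjoint; $V_e=\emptyset$ if $s=k/2$), with vertex set $V^{k,s}=\bigcup_vV_v\cup\bigcup_eV_e$ and edge set $\{V_u\cup V_v\cup V_e:e=uv\in E\}$. Its adjacency tensor $\mathscr{A}^{k,s}$ is the order $k$ tensor indexed by $V^{k,s}$ with entry $\frac1{(k-1)!}$ at $(i_1,\dots,i_k)$ if $\{i_1,\dots,i_k\}$ is an edge and $0$ otherwise; $\mathscr{Q}^{k,s}=\mathscr{D}^{k,s}+\mathscr{A}^{k,s}$, with $\mathscr{D}^{k,s}$ the diagonal tensor of vertex degrees. $\mathscr{B}^{k,s}$ is the quotient tensor of $\mathscr{Q}^{k,s}$ with respect to the partition of $V^{k,s}$ into the nonempty sets among $V_e$ ($e\in E$), $V_v$ ($v\in V$): it is the order $k$ tensor indexed by these parts (i.e. by $E\cup V$ if $s<k/2$ and by $V$ if $s=k/2$)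 with entries $b_{ii_2\cdots i_k}=\frac1{|V_i|}\sum_{j\in V_i}\sum_{j_2\in V_{i_2},\dots,j_k\in V_{i_k}}(\mathscr{Q}^{k,s})_{jj_2\cdots j_k}$. For an order $k$ tensor $\mathscr{T}$ indexed by a finite set $N$, $(\mathscr{T}x)_i=\sum_{i_2,\dots,i_k}t_{ii_2\cdots i_k}x_{i_2}\cdots x_{i_k}$; $\lambda\in\mathbb{R}$ is an $H$-eigenvalue if $\mathscr{T}x=\lambda x^{[k-1]}$ for some nonzero real $x$ (with $x^{[k-1]}_i=x_i^{k-1}$); $\lambda(\mathscr{T})$ is the largest $H$-eigenvalue. *)

theory Defs
  imports Complex_Main
begin

definition simple_graph :: "'a set \<Rightarrow> 'a set set \<Rightarrow> bool" where
  "simple_graph V E \<longleftrightarrow> finite V \<and> (\<forall>e\<in>E. e \<subseteq> V \<and> card e = 2)"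

definition graph_connected :: "'a set \<Rightarrow> 'a set set \<Rightarrow> bool" where
  "graph_connected V E \<longleftrightarrow> V \<noteq> {} \<and> (\<forall>u\<in>V. \<forall>v\<in>V. (u, v) \<in> {(a, b). {a, b} \<in> E}\<^sup>*)"

text \<open>
  A tensor of order \<open>k\<close> indexed by a finite set \<open>N\<close> is represented by a function on index lists;
  only its values on lists of length \<open>k\<close> with entries in \<open>N\<close> are relevant.
\<close>

type_synonym 'i tensor = "'i list \<Rightarrow> real"

definition tensor_apply :: "nat \<Rightarrow> 'i set \<Rightarrow> 'i tensor \<Rightarrow> ('i \<Rightarrow> real) \<Rightarrow> 'i \<Rightarrow> real" where
  "tensor_apply k N T x i =
     (\<Sum>is | set is \<subseteq> N \<and> length is = k - 1. T (i # is) * prod_list (map x is))"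

definition H_eigenvalue :: "nat \<Rightarrow> 'i set \<Rightarrow> 'i tensor \<Rightarrow> real \<Rightarrow> bool" where
  "H_eigenvalue k N T l \<longleftrightarrow>
     (\<exists>x. (\<exists>i\<in>N. x i \<noteq> 0) \<and> (\<forall>i\<in>N. tensor_apply k N T x i = l * x i ^ (k - 1)))"

definition is_largest_H_eigenvalue :: "nat \<Rightarrow> 'i set \<Rightarrow> 'i tensor \<Rightarrow> real \<Rightarrow> bool" where
  "is_largest_H_eigenvalue k N T l \<longleftrightarrow>
     H_eigenvalue k N T l \<and> (\<forall>m. H_eigenvalue k N T m \<longrightarrow> m \<le> l)"

definition largest_H_eigenvalue :: "nat \<Rightarrow> 'i set \<Rightarrow> 'i tensor \<Rightarrow> real" where
  "largest_H_eigenvalue k N T = (THE l. is_largest_H_eigenvalue k N T l)"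

text \<open>
  Tensors of a \<open>k\<close>-uniform hypergraph with edge set \<open>H\<close>. As every edge has \<open>k\<close> elements, a list of
  length \<open>k\<close> whose set of entries is an edge has distinct entries.
\<close>

definition adjacency_tensor :: "nat \<Rightarrow> 'i set set \<Rightarrow> 'i tensor" where
  "adjacency_tensor k H is = (if set is \<in> H then 1 / fact (k - 1) else 0)"

definition hyper_degree :: "'i set set \<Rightarrow> 'i \<Rightarrow> nat" where
  "hyper_degree H i = card {e \<in> H. i \<in> e}"

definition degree_tensor :: "'i set set \<Rightarrow> 'i tensor" where
  "degree_tensor H is = (if set is = {hd is} then real (hyper_degree H (hd is)) else 0)"

definition signless_laplacian_tensor :: "nat \<Rightarrow> 'i set set \<Rightarrow> 'i tensor" where
  "signless_laplacian_tensor k H is = degree_tensor H is + adjacency_tensor k H is"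

text \<open>
  The quotient tensor with respect to a partition is indexed by the blocks of the partition
  themselves; \<open>listset [A\<^sub>2, \<dots>, A\<^sub>k]\<close> is the set of lists \<open>[j\<^sub>2, \<dots>, j\<^sub>k]\<close> with \<open>j\<^sub>m \<in> A\<^sub>m\<close>.
\<close>

definition quotient_tensor :: "'i tensor \<Rightarrow> 'i set tensor" where
  "quotient_tensor T As =
     1 / real (card (hd As)) * (\<Sum>j\<in>hd As. \<Sum>js\<in>listset (tl As). T (j # js))"

text \<open>
  The generalized power hypergraph: \<open>VCopy v i\<close> with \<open>i < s\<close> are the vertices replacing \<open>v\<close>,
  and \<open>ECopy e i\<close> with \<open>i < k - 2 * s\<close> are those added for the edge \<open>e\<close>.
\<close>

datatype 'a gp_vertex = VCopy 'a nat | ECopy "'a set" nat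

definition gp_vblock :: "nat \<Rightarrow> 'a \<Rightarrow> 'a gp_vertex set" where
  "gp_vblock s v = VCopy v ` {..<s}"

definition gp_eblock :: "nat \<Rightarrow> nat \<Rightarrow> 'a set \<Rightarrow> 'a gp_vertex set" where
  "gp_eblock k s e = ECopy e ` {..<k - 2 * s}"

definition gp_verts :: "'a set \<Rightarrow> 'a set set \<Rightarrow> nat \<Rightarrow> nat \<Rightarrow> 'a gp_vertex set" where
  "gp_verts V E k s = (\<Union>v\<in>V. gp_vblock s v) \<union> (\<Union>e\<in>E. gp_eblock k s e)"

definition gp_edges :: "'a set set \<Rightarrow> nat \<Rightarrow> nat \<Rightarrow> 'a gp_vertex set set" where
  "gp_edges E k s = {gp_vblock s u \<union> gp_vblock s v \<union> gp_eblock k s {u, v} | u v. {u, v} \<in> E}"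

definition gp_partition :: "'a set \<Rightarrow> 'a set set \<Rightarrow> nat \<Rightarrow> nat \<Rightarrow> 'a gp_vertex set set" where
  "gp_partition V E k s = (gp_eblock k s ` E \<union> gp_vblock s ` V) - {{}}"

definition gp_Q :: "'a set set \<Rightarrow> nat \<Rightarrow> nat \<Rightarrow> 'a gp_vertex tensor" where
  "gp_Q E k s = signless_laplacian_tensor k (gp_edges E k s)"

definition gp_B :: "'a set set \<Rightarrow> nat \<Rightarrow> nat \<Rightarrow> 'a gp_vertex set tensor" where
  "gp_B E k s = quotient_tensor (gp_Q E k s)"

end

theory Submission
  imports Defs "HOL-Analysis.Analysis" "HOL-Combinatorics.Multiset_Permutations"
begin

text \<open>
  A nonnegative tensor with a positive eigenvector has the corresponding eigenvalue as its largest
  H-eigenvalue, so it suffices to find a positive eigenvector of the signless Laplacian tensor of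
  the power hypergraph that is constant on the blocks: it descends to the quotient tensor with the
  same eigenvalue \<open>\<rho>\<close>. Eliminating the entries at the edge blocks and substituting \<open>w = x\<^bsup>k/2\<^esup>\<close> turns
  the eigenvalue equations into the linear system \<open>(D + c A) w = \<rho> w\<close> on the graph itself, with
  \<open>c = (\<rho> - 1) powr - a\<close> and \<open>a = k / (2 s) - 1\<close>. A solution exists by the intermediate value theorem
  applied to the spectral radius of \<open>D + c A\<close>. As some vertex has degree at least 2, \<open>\<rho> > 2\<close>, so \<open>c\<close>
  grows when \<open>a\<close> decreases, and pairing the positive eigenvectors for two values of \<open>s\<close> shows that \<open>\<rho>\<close>
  grows with \<open>s\<close>.
\<close>

section \<open>Symmetric nonnegative matrices\<close>

definition qform :: "'a set \<Rightarrow> ('a \<Rightarrow> 'a \<Rightarrow> real) \<Rightarrow> ('a \<Rightarrow> real) \<Rightarrow> real" where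
  "qform V M x = (\<Sum>u\<in>V. \<Sum>v\<in>V. M u v * x u * x v)"

definition sqnorm :: "'a set \<Rightarrow> ('a \<Rightarrow> real) \<Rightarrow> real" where
  "sqnorm V x = (\<Sum>v\<in>V. (x v)\<^sup>2)"

lemma qform_scale: "qform V M (\<lambda>v. t * x v) = t\<^sup>2 * qform V M x"
  unfolding qform_def sum_distrib_left
  by (intro sum.cong refl) (simp add: power2_eq_square)

lemma sqnorm_scale: "sqnorm V (\<lambda>v. t * x v) = t\<^sup>2 * sqnorm V x"
  unfolding sqnorm_def sum_distrib_left by (simp add: power_mult_distrib)

lemma sqnorm_nonneg: "0 \<le> sqnorm V x"
  unfolding sqnorm_def by (simp add: sum_nonneg)

lemma sqnorm_eq_0_iff: "finite V \<Longrightarrow> sqnorm V x = 0 \<longleftrightarrow> (\<forall>v\<in>V. x v = 0)"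
  unfolding sqnorm_def by (simp add: sum_nonneg_eq_0_iff)

lemma abs_le_1_if_sqnorm_1:
  assumes "finite V" "sqnorm V x = 1" "v \<in> V"
  shows "\<bar>x v\<bar> \<le> 1"
proof -
  have "(x v)\<^sup>2 \<le> sqnorm V x"
    unfolding sqnorm_def using assms by (intro member_le_sum) auto
  then show ?thesis using assms by (simp add: abs_square_le_1)
qed

text \<open>Functions on the whole type carry the product topology. Fixing the values outside
  \<open>V\<close> to be 0 makes the sphere a closed subset of a product of compact intervals, which
  is compact by Tychonoff's theorem.\<close>

lemma compact_unit_sphere:
  fixes V :: "'a set"
  assumes "finite V"
  shows "compact {x. (\<forall>v. v \<notin> V \<longrightarrow> x v = 0) \<and> sqnorm V x = 1}"
proof -
  define C where "C = PiE UNIV (\<lambda>v. if v \<in> V then {-1..1} else {0::real})"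
  have "compact C"
    unfolding C_def compactin_euclidean_iff[symmetric] euclidean_product_topology[symmetric]
    by (subst compactin_PiE) (auto simp: compactin_euclidean_iff)
  moreover have "closed {x. sqnorm V x = 1}"
    unfolding sqnorm_def
    by (intro closed_Collect_eq continuous_intros continuous_on_product_coordinates)
  ultimately have "compact (C \<inter> {x. sqnorm V x = 1})" by (rule compact_Int_closed)
  moreover have "{x. (\<forall>v. v \<notin> V \<longrightarrow> x v = 0) \<and> sqnorm V x = 1} = C \<inter> {x. sqnorm V x = 1}"
    using abs_le_1_if_sqnorm_1[OF assms]
    by (fastforce simp: C_def PiE_UNIV_domain Pi_def abs_le_iff split: if_splits)
  ultimately show ?thesis by simp
qed

text \<open>A maximum over the compact sphere exists by continuity; both sides are homogeneous of
  degree 2, which extends the bound to every \<open>x\<close>.\<close>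

lemma rayleigh_quotient_attains_max:
  assumes "finite V" "V \<noteq> {}"
  obtains w where "sqnorm V w = 1" "\<And>x. qform V M x \<le> qform V M w * sqnorm V x"
proof -
  define S where "S = {x. (\<forall>v. v \<notin> V \<longrightarrow> x v = 0) \<and> sqnorm V x = 1}"
  have "compact S" unfolding S_def using compact_unit_sphere[OF assms(1)] .
  moreover obtain v0 where v0: "v0 \<in> V" using assms by auto
  have "(\<lambda>v. if v = v0 then 1 else 0) \<in> S"
    using v0 assms(1) by (auto simp: S_def sqnorm_def if_distrib[of "\<lambda>t. t\<^sup>2"] cong: if_cong)
  hence "S \<noteq> {}" by blast
  moreover have "continuous_on S (qform V M)"
    unfolding qform_def
    by (intro continuous_intros continuous_on_subset[OF continuous_on_product_coordinates]) auto
  ultimately obtain w where w: "w \<in> S" "\<And>x. x \<in> S \<Longrightarrow> qform V M x \<le> qform V M w"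
    using continuous_attains_sup[of S "qform V M"] by blast
  show ?thesis
  proof
    show "sqnorm V w = 1" using w(1) by (simp add: S_def)
    fix x
    show "qform V M x \<le> qform V M w * sqnorm V x"
    proof (cases "sqnorm V x = 0")
      case True
      hence "\<forall>v\<in>V. x v = 0" using assms(1) by (simp add: sqnorm_eq_0_iff)
      hence "qform V M x = 0" unfolding qform_def by simp
      with True show ?thesis by simp
    next
      case False
      define t where "t = 1 / sqrt (sqnorm V x)"
      have t: "t\<^sup>2 = 1 / sqnorm V x"
        by (simp add: t_def power_divide sqnorm_nonneg)
      \<comment> \<open>Values outside \<open>V\<close> affect neither \<open>qform\<close> nor
        \<open>sqnorm\<close>, but they must be cut off for membership in \<open>S\<close>.\<close>
      define y where "y = (\<lambda>v. t * (if v \<in> V then x v else 0))"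
      have "sqnorm V (\<lambda>v. if v \<in> V then x v else 0) = sqnorm V x"
        unfolding sqnorm_def by (intro sum.cong) auto
      hence "y \<in> S" using False unfolding y_def S_def by (auto simp: sqnorm_scale t)
      moreover have "qform V M (\<lambda>v. if v \<in> V then x v else 0) = qform V M x"
        unfolding qform_def by (intro sum.cong) auto
      hence "qform V M y = qform V M x / sqnorm V x" by (simp add: y_def qform_scale t)
      ultimately have "qform V M x / sqnorm V x \<le> qform V M w" using w(2)[of y] by simp
      thus ?thesis using False sqnorm_nonneg[of V x] by (simp add: pos_divide_le_eq)
    qed
  qed
qed

lemma linear_coeff_0_if_quadratic_nonneg:
  fixes b c :: real
  assumes "\<And>t. 0 \<le> b * t + c * t\<^sup>2"
  shows "b = 0"
proof (rule ccontr)
  assume "b \<noteq> 0"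
  \<comment> \<open>\<open>d\<close> exceeds both 0 and \<open>c\<close>, so at the point
    \<open>- b / d\<close> the quadratic term cannot compensate the negative linear one.\<close>
  define d where "d = \<bar>c\<bar> + 1"
  have d: "d > 0" "c < d" by (auto simp: d_def)
  have "0 \<le> b * (- b / d) + c * (- b / d)\<^sup>2" by (rule assms)
  also have "\<dots> = b\<^sup>2 / d\<^sup>2 * (c - d)" using d by (simp add: field_simps power2_eq_square)
  also have "\<dots> < 0" using d \<open>b \<noteq> 0\<close> by (intro mult_pos_neg) auto
  finally show False by simp
qed

text \<open>First-order optimality: adding \<open>t\<close> to the coordinate \<open>v\<close> of
  \<open>w\<close> turns the maximality of \<open>w\<close> into the nonnegativity of a quadratic
  polynomial in \<open>t\<close> without constant term. Its linear coefficient, which by symmetry of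
  \<open>M\<close> is twice the defect in the eigenvalue equation at \<open>v\<close>, must
  vanish.\<close>

lemma rayleigh_maximizer_is_eigenvector:
  assumes "finite V" "v \<in> V"
    and sym: "\<And>u v. M u v = M v u"
    and w: "sqnorm V w = 1" "\<And>x. qform V M x \<le> qform V M w * sqnorm V x"
  shows "(\<Sum>u\<in>V. M v u * w u) = qform V M w * w v"
proof -
  define l where "l = qform V M w"
  define r where "r = (\<Sum>u\<in>V. M v u * w u)"
  have "0 \<le> (2 * (l * w v - r)) * t + (l - M v v) * t\<^sup>2" for t
  proof -
    define e where "e = (\<lambda>u. if u = v then t else 0)"
    have e: "(\<Sum>u\<in>V. f u * e u) = f v * t" for f
    proof -
      have "(\<Sum>u\<in>V. f u * e u) = (\<Sum>u\<in>V. if u = v then f u * t else 0)"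
        by (intro sum.cong) (auto simp: e_def)
      thus ?thesis using assms(1,2) by simp
    qed
    have n: "sqnorm V (\<lambda>u. w u + e u) = 1 + 2 * w v * t + t\<^sup>2"
    proof -
      have "sqnorm V (\<lambda>u. w u + e u) = sqnorm V w + (\<Sum>u\<in>V. (2 * w u + e u) * e u)"
        unfolding sqnorm_def sum.distrib[symmetric]
        by (intro sum.cong) (auto simp: power2_eq_square algebra_simps)
      also have "(\<Sum>u\<in>V. (2 * w u + e u) * e u) = (2 * w v + e v) * t" by (rule e)
      finally show ?thesis by (simp add: w e_def power2_eq_square algebra_simps)
    qed
    have "qform V M (\<lambda>u. w u + e u) = (\<Sum>a\<in>V. \<Sum>b\<in>V. M a b * w a * w b)
      + (\<Sum>a\<in>V. \<Sum>b\<in>V. (M a b * w a) * e b) + (\<Sum>a\<in>V. (\<Sum>b\<in>V. M a b * w b) * e a)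
      + (\<Sum>a\<in>V. (\<Sum>b\<in>V. M a b * e b) * e a)"
      unfolding qform_def sum.distrib[symmetric] sum_distrib_right
      by (intro sum.cong) (auto simp: algebra_simps)
    also have "\<dots> = l + (\<Sum>a\<in>V. M a v * w a) * t + r * t + M v v * t\<^sup>2"
      by (simp only: e l_def qform_def r_def) (simp add: power2_eq_square sum_distrib_right)
    also have "(\<Sum>a\<in>V. M a v * w a) = r"
      unfolding r_def by (intro sum.cong refl) (simp add: sym[of v])
    finally have "qform V M (\<lambda>u. w u + e u) = l + 2 * r * t + M v v * t\<^sup>2" by simp
    with w(2)[of "\<lambda>u. w u + e u"] show ?thesis
      unfolding n l_def[symmetric] by (simp add: algebra_simps)
  qed
  hence "2 * (l * w v - r) = 0" by (rule linear_coeff_0_if_quadratic_nonneg)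
  thus ?thesis by (simp add: l_def r_def)
qed

text \<open>Replacing a maximizer by its absolute value keeps the norm and, as \<open>M\<close> is
  nonnegative, does not decrease the form.\<close>

lemma rayleigh_maximizer_nonneg:
  assumes "finite V" "V \<noteq> {}" and nn: "\<And>u v. 0 \<le> M u v"
  obtains w where "sqnorm V w = 1" "\<And>x. qform V M x \<le> qform V M w * sqnorm V x" "\<And>v. 0 \<le> w v"
proof -
  obtain w where w: "sqnorm V w = 1" "\<And>x. qform V M x \<le> qform V M w * sqnorm V x"
    using rayleigh_quotient_attains_max[OF assms(1,2)] by blast
  have "qform V M w \<le> qform V M (\<lambda>v. \<bar>w v\<bar>)"
    unfolding qform_def
  proof (intro sum_mono)
    fix u v
    have "M u v * (w u * w v) \<le> M u v * \<bar>w u * w v\<bar>" using nn by (intro mult_left_mono) auto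
    thus "M u v * w u * w v \<le> M u v * \<bar>w u\<bar> * \<bar>w v\<bar>" by (simp add: abs_mult mult.assoc)
  qed
  hence "qform V M x \<le> qform V M (\<lambda>v. \<bar>w v\<bar>) * sqnorm V x" for x
    using w(2)[of x] sqnorm_nonneg[of V x] by (meson mult_right_mono order_trans)
  moreover have "sqnorm V (\<lambda>v. \<bar>w v\<bar>) = 1" using w(1) by (simp add: sqnorm_def)
  ultimately show ?thesis using that by fastforce
qed

section \<open>The weighted signless Laplacian of a graph\<close>

text \<open>On a simple graph this is the matrix D + c A; \<open>hyper_degree\<close> of a set of
  two-element edges is the usual vertex degree.\<close>

definition weighted_Q :: "'a set set \<Rightarrow> real \<Rightarrow> 'a \<Rightarrow> 'a \<Rightarrow> real" where
  "weighted_Q E c u v =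
    (if u = v then real (hyper_degree E u) else 0) + (if {u, v} \<in> E then c else 0)"

lemma weighted_Q_sym: "weighted_Q E c u v = weighted_Q E c v u"
  by (auto simp: weighted_Q_def insert_commute)

lemma weighted_Q_nonneg: "0 \<le> c \<Longrightarrow> 0 \<le> weighted_Q E c u v"
  by (auto simp: weighted_Q_def)

section \<open>Neighbours and degrees in connected graphs\<close>

lemma simple_graph_finite_edges: "simple_graph V E \<Longrightarrow> finite E"
  unfolding simple_graph_def by (meson Pow_iff finite_Pow_iff finite_subset subsetI)

lemma simple_graph_edgeD:
  assumes "simple_graph V E" "{u, v} \<in> E"
  shows "u \<in> V" "v \<in> V" "u \<noteq> v"
  using assms by (auto simp: simple_graph_def)

lemma connected_graph_induct:
  assumes "graph_connected V E" "u \<in> V" "v \<in> V" "P u"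
    and "\<And>a b. P a \<Longrightarrow> {a, b} \<in> E \<Longrightarrow> P b"
  shows "P v"
proof -
  have "(u, v) \<in> {(a, b). {a, b} \<in> E}\<^sup>*" using assms(1-3) by (auto simp: graph_connected_def)
  thus ?thesis by (induction rule: rtrancl_induct) (use assms(4,5) in auto)
qed

lemma connected_graph_has_neighbour:
  assumes "graph_connected V E" "card V \<ge> 2" "u \<in> V"
  obtains v where "{u, v} \<in> E"
proof -
  have "\<not> V \<subseteq> {u}" using assms(2) card_mono[of "{u}" V] by auto
  then obtain v where v: "v \<in> V" "v \<noteq> u" by blast
  hence "(u, v) \<in> {(a, b). {a, b} \<in> E}\<^sup>*" using assms by (auto simp: graph_connected_def)
  thus ?thesis using v that by (auto elim: converse_rtranclE)
qed

text \<open>If all degrees were at most 1, a vertex and its only neighbour would form a whole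
  component, and \<open>V\<close> would have at most two elements.\<close>

lemma connected_graph_has_degree_2:
  assumes "simple_graph V E" "graph_connected V E" "card V > 2"
  obtains v where "v \<in> V" "hyper_degree E v \<ge> 2"
proof (rule ccontr)
  assume "\<not> thesis"
  with that have deg: "hyper_degree E v < 2" if "v \<in> V" for v using that by force
  have uniq: "x = y" if "{v, x} \<in> E" "{v, y} \<in> E" for v x y
  proof (rule ccontr)
    assume "x \<noteq> y"
    hence "card {{v, x}, {v, y}} = 2" by (auto simp: doubleton_eq_iff)
    moreover have "card {{v, x}, {v, y}} \<le> hyper_degree E v"
      unfolding hyper_degree_def using that simple_graph_finite_edges[OF assms(1)]
      by (intro card_mono) auto
    ultimately show False using deg[of v] simple_graph_edgeD[OF assms(1) that(1)] by simp
  qed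
  obtain u where u: "u \<in> V" using assms(2) by (auto simp: graph_connected_def)
  obtain y where y: "{u, y} \<in> E"
    using connected_graph_has_neighbour[OF assms(2) _ u] assms(3) by auto
  have "v \<in> {u, y}" if "v \<in> V" for v
    using assms(2) u that
  proof (rule connected_graph_induct[where P = "\<lambda>v. v \<in> {u, y}"])
    fix a b assume "a \<in> {u, y}" "{a, b} \<in> E"
    thus "b \<in> {u, y}" using uniq[of u y b] uniq[of y u b] y by (auto simp: insert_commute)
  qed simp
  hence "card V \<le> card {u, y}" by (intro card_mono) auto
  also have "\<dots> \<le> 2" by (simp add: card_insert_if)
  finally show False using assms(3) by simp
qed

section \<open>Positive eigenvectors and the fixed point equation\<close>

text \<open>Perron-Frobenius argument: where \<open>w\<close> vanishes, the eigenvalue equation is a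
  vanishing sum of nonnegative terms, so \<open>w\<close> vanishes at all neighbours too. By
  connectedness a single zero would make \<open>w\<close> zero on \<open>V\<close>, against its unit
  norm.\<close>

lemma weighted_Q_eigenvector_pos:
  assumes "simple_graph V E" "graph_connected V E" "c > 0"
    and w: "\<And>v. 0 \<le> w v" "sqnorm V w = 1"
    and eig: "\<And>v. v \<in> V \<Longrightarrow> (\<Sum>u\<in>V. weighted_Q E c v u * w u) = \<rho> * w v"
    and "v \<in> V"
  shows "0 < w v"
proof (rule ccontr)
  have fin: "finite V" using assms(1) by (simp add: simple_graph_def)
  assume "\<not> 0 < w v"
  with w(1)[of v] have 0: "w v = 0" by linarith
  have "w b = 0" if b: "b \<in> V" for b
    using assms(2) \<open>v \<in> V\<close> b 0
  proof (rule connected_graph_induct[where P = "\<lambda>b. w b = 0"])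
    fix a b assume ab: "w a = 0" "{a, b} \<in> E"
    note V = simple_graph_edgeD[OF assms(1) ab(2)]
    have "(\<Sum>u\<in>V. weighted_Q E c a u * w u) = 0" using eig[OF V(1)] ab(1) by simp
    moreover have "0 \<le> weighted_Q E c a u * w u" for u
      using w(1)[of u] weighted_Q_nonneg[of c E a u] assms(3) by simp
    ultimately have "weighted_Q E c a b * w b = 0"
      using fin V(2) by (subst (asm) sum_nonneg_eq_0_iff) auto
    moreover have "weighted_Q E c a b > 0" using ab(2) V(3) assms(3) by (simp add: weighted_Q_def)
    ultimately show "w b = 0" by simp
  qed
  with fin have "sqnorm V w = 0" by (simp add: sqnorm_eq_0_iff)
  with w(2) show False by simp
qed

text \<open>Entries of a unit vector have absolute value at most 1. The bound \<open>B u\<close> may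
  depend on the row, so that it serves both the Lipschitz estimate, where it is constant, and the
  upper bound by degrees.\<close>

lemma abs_qform_le:
  assumes "finite V" "sqnorm V x = 1" "\<And>u v. u \<in> V \<Longrightarrow> v \<in> V \<Longrightarrow> \<bar>M u v\<bar> \<le> B u"
  shows "\<bar>qform V M x\<bar> \<le> (\<Sum>u\<in>V. \<Sum>v\<in>V. B u)"
proof -
  have "\<bar>qform V M x\<bar> \<le> (\<Sum>u\<in>V. \<Sum>v\<in>V. \<bar>M u v * x u * x v\<bar>)"
    unfolding qform_def by (rule order_trans[OF sum_abs sum_mono[OF sum_abs]])
  also have "\<dots> \<le> (\<Sum>u\<in>V. \<Sum>v\<in>V. B u)"
  proof (intro sum_mono)
    fix u v assume h: "u \<in> V" "v \<in> V"
    have "\<bar>M u v\<bar> * (\<bar>x u\<bar> * \<bar>x v\<bar>) \<le> B u * (1 * 1)"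
      using abs_le_1_if_sqnorm_1[OF assms(1,2)] assms(3)[OF h] h
      by (intro mult_mono) auto
    thus "\<bar>M u v * x u * x v\<bar> \<le> B u" by (simp add: abs_mult mult.assoc)
  qed
  finally show ?thesis .
qed

lemma qform_diff: "qform V M x - qform V M' x = qform V (\<lambda>u v. M u v - M' u v) x"
  unfolding qform_def sum_subtractf[symmetric] by (intro sum.cong refl) (simp add: algebra_simps)

text \<open>With \<open>\<mu> c\<close> the maximal Rayleigh quotient of D + c A, the required
  \<open>\<rho>\<close> is a zero of \<open>\<mu> ((r - 1) powr - a) - r\<close> on an interval from
  2 to \<open>K\<close>, and \<open>w\<close> is the corresponding maximizer.\<close>

lemma weighted_Q_fixed_point:
  fixes a :: real
  assumes G: "simple_graph V E" "graph_connected V E" "card V > 2" and a: "a \<ge> 0"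
  obtains \<rho> w where "\<rho> > 2" "\<And>v. v \<in> V \<Longrightarrow> 0 < w v"
    "\<And>v. v \<in> V \<Longrightarrow> (\<Sum>u\<in>V. weighted_Q E ((\<rho> - 1) powr - a) v u * w u) = \<rho> * w v"
proof -
  have fin: "finite V" "V \<noteq> {}" using G by (auto simp: simple_graph_def graph_connected_def)
  obtain v0 where v0: "v0 \<in> V" "hyper_degree E v0 \<ge> 2"
    using connected_graph_has_degree_2[OF G] .
  \<comment> \<open>Maximizers are chosen for every real \<open>c\<close>, so that
    \<open>\<mu>\<close> is defined and continuous on the whole line; nonnegativity is claimed only
    where the matrix is nonnegative.\<close>
  have "\<exists>w. sqnorm V w = 1 \<and>
      (\<forall>x. qform V (weighted_Q E c) x \<le> qform V (weighted_Q E c) w * sqnorm V x) \<and>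
      (c \<ge> 0 \<longrightarrow> (\<forall>v. 0 \<le> w v))" for c
  proof (cases "c \<ge> 0")
    case True
    show ?thesis
      by (rule rayleigh_maximizer_nonneg[where M = "weighted_Q E c", OF fin weighted_Q_nonneg[OF True]])
        blast
  next
    case False
    show ?thesis
      by (rule rayleigh_quotient_attains_max[OF fin, of "weighted_Q E c"]) (use False in blast)
  qed
  then obtain W where W1: "\<And>c. sqnorm V (W c) = 1"
    and W: "\<And>c x. qform V (weighted_Q E c) x \<le> qform V (weighted_Q E c) (W c) * sqnorm V x"
    and W0: "\<And>c v. c \<ge> 0 \<Longrightarrow> 0 \<le> W c v"
    by metis
  define \<mu> where "\<mu> c = qform V (weighted_Q E c) (W c)" for c
  define n where "n = (\<Sum>u\<in>V. \<Sum>v\<in>V. 1 :: real)"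
  have n: "n \<ge> 0" by (simp add: n_def)
  \<comment> \<open>The maximizer \<open>W c\<close> is a competitor for \<open>c'\<close>, so the
    difference of the maxima is at most the difference of the two forms at \<open>W c\<close>, whose
    matrices differ by at most \<open>\<bar>c - c'\<bar>\<close> in each entry.\<close>
  have lip: "\<mu> c - \<mu> c' \<le> n * \<bar>c - c'\<bar>" for c c'
  proof -
    have "qform V (weighted_Q E c') (W c) \<le> \<mu> c'" using W[of c' "W c"] W1 by (simp add: \<mu>_def)
    hence "\<mu> c - \<mu> c' \<le> qform V (weighted_Q E c) (W c) - qform V (weighted_Q E c') (W c)"
      by (simp add: \<mu>_def)
    also have "\<dots> \<le> \<bar>qform V (\<lambda>u v. weighted_Q E c u v - weighted_Q E c' u v) (W c)\<bar>"
      by (simp add: qform_diff)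
    also have "\<dots> \<le> (\<Sum>u\<in>V. \<Sum>v\<in>V. \<bar>c - c'\<bar>)"
      by (intro abs_qform_le fin W1) (auto simp: weighted_Q_def)
    finally show ?thesis by (simp add: n_def mult_ac)
  qed
  have "n-lipschitz_on UNIV \<mu>"
  proof (rule lipschitz_onI[OF _ n])
    fix c c'
    show "dist (\<mu> c) (\<mu> c') \<le> n * dist c c'"
      using lip[of c c'] lip[of c' c] by (simp add: dist_real_def abs_minus_commute abs_le_iff)
  qed
  hence cont: "continuous_on UNIV \<mu>" by (rule lipschitz_on_continuous_on)
  \<comment> \<open>For \<open>c\<close> between 0 and 1, every entry of row \<open>u\<close> is at
    most the degree of \<open>u\<close> plus 1.\<close>
  define K where "K = (\<Sum>u\<in>V. \<Sum>v\<in>V. real (hyper_degree E u) + 1)"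
  have upper: "\<mu> c \<le> K" if "0 \<le> c" "c \<le> 1" for c
  proof -
    have "\<bar>\<mu> c\<bar> \<le> K" unfolding \<mu>_def K_def
      using that by (intro abs_qform_le fin W1) (auto simp: weighted_Q_def)
    thus ?thesis by simp
  qed
  \<comment> \<open>The coordinate vector at \<open>v0\<close> gives the diagonal entry, which is
    the degree of \<open>v0\<close>, as a value of the Rayleigh quotient.\<close>
  have lower: "2 \<le> \<mu> c" for c
  proof -
    define x where "x = (\<lambda>v. if v = v0 then 1 else 0 :: real)"
    have "sqnorm V x = (\<Sum>v\<in>V. if v = v0 then 1 else 0)"
      unfolding sqnorm_def x_def by (intro sum.cong) auto
    hence "sqnorm V x = 1" using fin v0 by simp
    moreover have "qform V (weighted_Q E c) x = (\<Sum>u\<in>V. if u = v0 then (\<Sum>v\<in>V. if v = v0 then weighted_Q E c v0 v0 else 0) else 0)"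
      unfolding qform_def x_def by (intro sum.cong) (auto intro!: sum.cong)
    hence "qform V (weighted_Q E c) x = weighted_Q E c v0 v0" using fin v0 by simp
    moreover have "{v0} \<notin> E" using G(1) by (auto simp: simple_graph_def)
    ultimately show ?thesis using W[of c x] v0(2) by (simp add: \<mu>_def weighted_Q_def)
  qed
  have K: "2 \<le> K" using upper[of 1] lower[of 1] by simp
  define g where "g = (\<lambda>r. \<mu> ((r - 1) powr - a) - r)"
  have "continuous_on {2..K} g" unfolding g_def
    by (intro continuous_intros continuous_on_compose2[OF cont]) auto
  moreover have "g K \<le> 0"
  proof -
    \<comment> \<open>Since \<open>K - 1 \<ge> 1\<close>, a nonpositive exponent keeps the weight in
      the range where \<open>upper\<close> applies.\<close>
    have "(K - 1) powr - a \<le> (K - 1) powr 0" using K a by (intro powr_mono) auto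
    hence "(K - 1) powr - a \<le> 1" using K by simp
    thus ?thesis unfolding g_def using upper[of "(K - 1) powr - a"] by simp
  qed
  moreover have "0 \<le> g 2" unfolding g_def using lower by simp
  ultimately obtain \<rho> where \<rho>: "2 \<le> \<rho>" "g \<rho> = 0" using IVT2'[of g K 0 2] K by auto
  define c where "c = (\<rho> - 1) powr - a"
  have c: "c > 0" using \<rho> by (simp add: c_def)
  have \<mu>c: "\<mu> c = \<rho>" using \<rho>(2) by (simp add: g_def c_def)
  have eig: "(\<Sum>u\<in>V. weighted_Q E c v u * W c u) = \<rho> * W c v" if "v \<in> V" for v
    using rayleigh_maximizer_is_eigenvector[OF fin(1) that weighted_Q_sym W1 W, of c] \<mu>c
    by (simp add: \<mu>_def)
  have pos: "0 < W c v" if "v \<in> V" for v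
    using weighted_Q_eigenvector_pos[OF G(1,2) c W0 W1 eig that] c by simp
  obtain y where y: "{v0, y} \<in> E" using connected_graph_has_neighbour[OF G(2) _ v0(1)] G(3) by auto
  note y' = simple_graph_edgeD[OF G(1) y]
  \<comment> \<open>The intermediate value theorem yields only \<open>\<rho> \<ge> 2\<close>. In row
    \<open>v0\<close> the diagonal term alone contributes at least \<open>2 * W c v0\<close>, and
    the edge to \<open>y\<close> adds a positive amount, so the inequality is strict.\<close>
  have "2 * W c v0 < (\<Sum>u\<in>{v0, y}. weighted_Q E c v0 u * W c u)"
  proof -
    have "weighted_Q E c v0 v0 \<ge> 2" "weighted_Q E c v0 y = c"
      using v0(2) c y y'(3) by (auto simp: weighted_Q_def)
    moreover have "0 < c * W c y" using c pos[OF y'(2)] by simp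
    moreover have "2 * W c v0 \<le> weighted_Q E c v0 v0 * W c v0"
      using calculation(1) pos[OF v0(1)] by (intro mult_right_mono) auto
    ultimately show ?thesis using y'(3) by simp
  qed
  also have "\<dots> \<le> (\<Sum>u\<in>V. weighted_Q E c v0 u * W c u)"
    using fin y' weighted_Q_nonneg[of c E] W0[of c] c by (intro sum_mono2 mult_nonneg_nonneg) auto
  also have "\<dots> = \<rho> * W c v0" by (rule eig[OF v0(1)])
  finally have "\<rho> > 2" using pos[OF v0(1)] by simp
  thus ?thesis using that[of \<rho> "W c"] pos eig by (simp add: c_def)
qed

text \<open>Suppose \<open>\<sigma> \<le> \<rho>\<close>. As \<open>\<rho> - 1 > 1\<close>, lowering
  the exponent from \<open>a\<close> to \<open>b\<close> strictly increases the weight, and passing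
  from \<open>\<rho>\<close> to \<open>\<sigma>\<close> does not decrease it, so
  \<open>c < d\<close>. Pairing each eigenvalue equation with the other eigenvector then equates
  \<open>\<sigma> - \<rho>\<close> times a nonnegative sum with a positive sum over adjacent
  pairs.\<close>

lemma weighted_Q_fixed_point_strict_antimono:
  fixes a b :: real
  assumes G: "simple_graph V E" "graph_connected V E" "card V > 2" and ab: "b < a" "0 \<le> b"
    and \<rho>: "\<rho> > 2" "\<And>v. v \<in> V \<Longrightarrow> 0 < w v"
      "\<And>v. v \<in> V \<Longrightarrow> (\<Sum>u\<in>V. weighted_Q E ((\<rho> - 1) powr - a) v u * w u) = \<rho> * w v"
    and \<sigma>: "\<sigma> > 2" "\<And>v. v \<in> V \<Longrightarrow> 0 < y v"
      "\<And>v. v \<in> V \<Longrightarrow> (\<Sum>u\<in>V. weighted_Q E ((\<sigma> - 1) powr - b) v u * y u) = \<sigma> * y v"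
  shows "\<rho> < \<sigma>"
proof (rule ccontr)
  assume "\<not> \<rho> < \<sigma>"
  hence le: "\<sigma> \<le> \<rho>" by simp
  define c where "c = (\<rho> - 1) powr - a"
  define d where "d = (\<sigma> - 1) powr - b"
  have "c < (\<rho> - 1) powr - b" unfolding c_def using \<rho>(1) ab by (intro powr_less_mono) auto
  also have "\<dots> \<le> d" unfolding d_def using \<rho>(1) \<sigma>(1) ab le by (intro powr_mono2') auto
  finally have cd: "c < d" .
  have fin: "finite V" using G(1) by (simp add: simple_graph_def)
  define D where "D u v = weighted_Q E d u v * y v * w u - weighted_Q E c u v * y v * w u" for u v
  \<comment> \<open>The degree terms of the two matrices cancel; only adjacent pairs remain.\<close>
  have D: "D u v = (if {u, v} \<in> E then (d - c) * (y v * w u) else 0)" for u v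
    by (auto simp: D_def weighted_Q_def algebra_simps)
  obtain p where p: "p \<in> V" using G(2) by (auto simp: graph_connected_def)
  obtain q where q: "{p, q} \<in> E" using connected_graph_has_neighbour[OF G(2) _ p] G(3) by auto
  note q' = simple_graph_edgeD[OF G(1) q]
  have nn: "0 \<le> D u v" if "u \<in> V" "v \<in> V" for u v
    using that cd \<rho>(2) \<sigma>(2) by (auto simp: D intro!: mult_nonneg_nonneg less_imp_le)
  have "0 < D p q" using q q' cd \<rho>(2) \<sigma>(2) by (simp add: D)
  also have "\<dots> \<le> (\<Sum>v\<in>V. D p v)" using q' fin nn[OF p] by (intro member_le_sum) auto
  also have "\<dots> \<le> (\<Sum>u\<in>V. \<Sum>v\<in>V. D u v)"
    using p fin nn by (intro member_le_sum[where f = "\<lambda>u. \<Sum>v\<in>V. D u v"] sum_nonneg) auto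
  also have "\<dots> = (\<Sum>u\<in>V. (\<Sum>v\<in>V. weighted_Q E d u v * y v) * w u)
      - (\<Sum>u\<in>V. \<Sum>v\<in>V. weighted_Q E c u v * y v * w u)"
    by (simp add: D_def sum_subtractf sum_distrib_right)
  \<comment> \<open>Symmetry moves the matrix with weight \<open>c\<close> from \<open>y\<close> to
    its own eigenvector \<open>w\<close>.\<close>
  also have "(\<Sum>u\<in>V. \<Sum>v\<in>V. weighted_Q E c u v * y v * w u) =
      (\<Sum>v\<in>V. (\<Sum>u\<in>V. weighted_Q E c v u * w u) * y v)"
    unfolding sum_distrib_right
    by (subst sum.swap) (auto simp: weighted_Q_sym[of E c] mult_ac intro!: sum.cong)
  also have "(\<Sum>u\<in>V. (\<Sum>v\<in>V. weighted_Q E d u v * y v) * w u) = (\<Sum>u\<in>V. \<sigma> * y u * w u)"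
    using \<sigma>(3) by (intro sum.cong refl) (simp add: d_def)
  also have "(\<Sum>v\<in>V. (\<Sum>u\<in>V. weighted_Q E c v u * w u) * y v) = (\<Sum>u\<in>V. \<rho> * w u * y u)"
    using \<rho>(3) by (intro sum.cong refl) (simp add: c_def)
  also have "(\<Sum>u\<in>V. \<sigma> * y u * w u) - (\<Sum>u\<in>V. \<rho> * w u * y u) = (\<sigma> - \<rho>) * (\<Sum>u\<in>V. w u * y u)"
    unfolding sum_distrib_left sum_subtractf[symmetric]
    by (intro sum.cong refl) (simp add: algebra_simps)
  also have "\<dots> \<le> 0"
    using le \<rho>(2) \<sigma>(2) by (intro mult_nonpos_nonneg sum_nonneg mult_nonneg_nonneg) (auto intro: less_imp_le)
  finally show False by simp
qed

section \<open>Nonnegative tensors and quotient tensors\<close>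

text \<open>Let \<open>x\<close> be an eigenvector for \<open>m\<close> and \<open>t\<close> the
  least number with \<open>\<bar>x l\<bar> \<le> t * y l\<close> on \<open>N\<close>. At an index
  \<open>i\<close> where equality holds, bounding the equation for \<open>x\<close> termwise by the
  one for \<open>y\<close> gives \<open>m \<le> \<rho>\<close>.\<close>

lemma positive_eigenvector_imp_largest_H_eigenvalue:
  assumes fin: "finite N" "N \<noteq> {}"
    and nn: "\<And>is. 0 \<le> T is"
    and pos: "\<And>i. i \<in> N \<Longrightarrow> 0 < y i"
    and eig: "\<And>i. i \<in> N \<Longrightarrow> tensor_apply k N T y i = \<rho> * y i ^ (k - 1)"
  shows "is_largest_H_eigenvalue k N T \<rho>"
  unfolding is_largest_H_eigenvalue_def
proof (intro conjI allI impI)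
  obtain i0 where "i0 \<in> N" using fin by auto
  with pos have "\<exists>i\<in>N. y i \<noteq> 0" by force
  with eig show "H_eigenvalue k N T \<rho>" unfolding H_eigenvalue_def by blast
next
  fix m assume "H_eigenvalue k N T m"
  then obtain x j where j: "j \<in> N" "x j \<noteq> 0"
    and x: "\<And>i. i \<in> N \<Longrightarrow> tensor_apply k N T x i = m * x i ^ (k - 1)"
    unfolding H_eigenvalue_def by blast
  define t where "t = Max ((\<lambda>i. \<bar>x i\<bar> / y i) ` N)"
  have "t \<in> (\<lambda>i. \<bar>x i\<bar> / y i) ` N" unfolding t_def using fin by (intro Max_in) auto
  then obtain i where i: "i \<in> N" "t = \<bar>x i\<bar> / y i" by blast
  have le: "\<bar>x l\<bar> / y l \<le> t" if "l \<in> N" for l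
    unfolding t_def using fin that by (intro Max_ge) auto
  have xle: "\<bar>x l\<bar> \<le> t * y l" if "l \<in> N" for l
    using le[OF that] pos[OF that] by (simp add: pos_divide_le_eq)
  have "0 < \<bar>x j\<bar> / y j" using j pos by simp
  with le[OF j(1)] have t: "t > 0" by linarith
  have xi: "\<bar>x i\<bar> = t * y i" using i pos[of i] by simp
  have prod: "\<bar>prod_list (map x is)\<bar> \<le> t ^ length is * prod_list (map y is)"
    if "set is \<subseteq> N" for "is"
    using that
  proof (induction "is")
    case (Cons a "is")
    have "\<bar>x a\<bar> * \<bar>prod_list (map x is)\<bar> \<le> (t * y a) * (t ^ length is * prod_list (map y is))"
      using Cons pos[of a] t xle[of a] by (intro mult_mono) auto
    thus ?case by (simp add: abs_mult mult_ac)
  qed simp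
  have "m * \<bar>x i\<bar> ^ (k - 1) \<le> \<bar>m * x i ^ (k - 1)\<bar>"
    by (simp add: abs_mult power_abs mult_right_mono)
  also have "\<dots> = \<bar>tensor_apply k N T x i\<bar>" using x[OF i(1)] by simp
  also have "\<dots> \<le> (\<Sum>is | set is \<subseteq> N \<and> length is = k - 1. \<bar>T (i # is) * prod_list (map x is)\<bar>)"
    unfolding tensor_apply_def by (rule sum_abs)
  also have "\<dots> \<le> (\<Sum>is | set is \<subseteq> N \<and> length is = k - 1. t ^ (k - 1) * (T (i # is) * prod_list (map y is)))"
  proof (intro sum_mono)
    fix "is" assume "is \<in> {is. set is \<subseteq> N \<and> length is = k - 1}"
    then have "T (i # is) * \<bar>prod_list (map x is)\<bar> \<le> T (i # is) * (t ^ (k - 1) * prod_list (map y is))"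
      using prod[of "is"] nn by (intro mult_left_mono) auto
    thus "\<bar>T (i # is) * prod_list (map x is)\<bar> \<le> t ^ (k - 1) * (T (i # is) * prod_list (map y is))"
      using nn[of "i # is"] by (simp add: abs_mult mult_ac)
  qed
  also have "\<dots> = t ^ (k - 1) * tensor_apply k N T y i"
    unfolding tensor_apply_def sum_distrib_left ..
  also have "\<dots> = \<rho> * \<bar>x i\<bar> ^ (k - 1)" using eig[OF i(1)] by (simp add: xi power_mult_distrib)
  finally have "m * \<bar>x i\<bar> ^ (k - 1) \<le> \<rho> * \<bar>x i\<bar> ^ (k - 1)" .
  moreover have "0 < \<bar>x i\<bar> ^ (k - 1)" using xi t pos[OF i(1)] by simp
  ultimately show "m \<le> \<rho>" by (simp add: mult_le_cancel_right)
qed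

lemma largest_H_eigenvalue_eqI:
  "is_largest_H_eigenvalue k N T l \<Longrightarrow> largest_H_eigenvalue k N T = l"
  unfolding largest_H_eigenvalue_def
  by (rule the_equality) (auto simp: is_largest_H_eigenvalue_def intro: antisym)

section \<open>Quotient tensors and vectors constant on blocks\<close>

lemma in_listset_iff: "js \<in> listset As \<longleftrightarrow> list_all2 (\<in>) js As"
  by (induction As arbitrary: js) (auto simp: set_Cons_def list_all2_Cons2)

text \<open>Each list over the union lies in the product of exactly one list of blocks: take the
  block of every entry, which is unique by disjointness.\<close>

lemma sum_listset_partition:
  fixes f :: "'i list \<Rightarrow> real"
  assumes "finite (\<Union>P)"
    and disj: "\<And>A B j. A \<in> P \<Longrightarrow> B \<in> P \<Longrightarrow> j \<in> A \<Longrightarrow> j \<in> B \<Longrightarrow> A = B"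
  shows "(\<Sum>As | set As \<subseteq> P \<and> length As = n. \<Sum>js\<in>listset As. f js) =
    (\<Sum>js | set js \<subseteq> \<Union>P \<and> length js = n. f js)"
proof -
  have finP: "finite P" using assms(1) by (rule finite_UnionD)
  have sub: "listset As \<subseteq> {js. set js \<subseteq> \<Union>P \<and> length js = n}"
    if "set As \<subseteq> P" "length As = n" for As
  proof
    fix js assume "js \<in> listset As"
    hence "list_all2 (\<in>) js As" by (simp add: in_listset_iff)
    hence "set js \<subseteq> \<Union>(set As) \<and> length js = length As"
      by (induction rule: list_all2_induct) auto
    with that show "js \<in> {js. set js \<subseteq> \<Union>P \<and> length js = n}"
      using Union_mono[OF that(1)] by auto
  qed
  have "(\<Sum>As | set As \<subseteq> P \<and> length As = n. \<Sum>js\<in>listset As. f js) =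
    sum f (\<Union>As\<in>{As. set As \<subseteq> P \<and> length As = n}. listset As)"
  proof (rule sum.UNION_disjoint[symmetric])
    show "finite {As. set As \<subseteq> P \<and> length As = n}" by (rule finite_lists_length_eq[OF finP])
    show "\<forall>As\<in>{As. set As \<subseteq> P \<and> length As = n}. finite (listset As)"
      using sub finite_lists_length_eq[OF assms(1), of n] by (auto intro: finite_subset)
    show "\<forall>As\<in>{As. set As \<subseteq> P \<and> length As = n}. \<forall>Bs\<in>{As. set As \<subseteq> P \<and> length As = n}.
      As \<noteq> Bs \<longrightarrow> listset As \<inter> listset Bs = {}"
    proof (intro ballI impI, rule ccontr)
      fix As Bs assume h: "As \<in> {As. set As \<subseteq> P \<and> length As = n}" "Bs \<in> {As. set As \<subseteq> P \<and> length As = n}"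
        "As \<noteq> Bs" "listset As \<inter> listset Bs \<noteq> {}"
      then obtain js where js: "list_all2 (\<in>) js As" "list_all2 (\<in>) js Bs"
        by (auto simp: in_listset_iff)
      have "As = Bs"
      proof (rule nth_equalityI)
        show "length As = length Bs" using h by simp
        fix i assume "i < length As"
        with js h show "As ! i = Bs ! i"
          by (intro disj[of _ _ "js ! i"]) (auto simp: list_all2_conv_all_nth subset_iff)
      qed
      with h show False by simp
    qed
  qed
  also have "(\<Union>As\<in>{As. set As \<subseteq> P \<and> length As = n}. listset As) = {js. set js \<subseteq> \<Union>P \<and> length js = n}"
  proof (intro equalityI subsetI)
    fix js assume js: "js \<in> {js. set js \<subseteq> \<Union>P \<and> length js = n}"
    then have "\<forall>j\<in>set js. \<exists>A. A \<in> P \<and> j \<in> A" by auto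
    then obtain b where b: "\<And>j. j \<in> set js \<Longrightarrow> b j \<in> P \<and> j \<in> b j" by metis
    have "js \<in> listset (map b js)" using b by (simp add: in_listset_iff list_all2_conv_all_nth)
    moreover have "set (map b js) \<subseteq> P" "length (map b js) = n" using b js by auto
    ultimately show "js \<in> (\<Union>As\<in>{As. set As \<subseteq> P \<and> length As = n}. listset As)" by blast
  qed (use sub in blast)
  finally show ?thesis .
qed

text \<open>For a vector constant on the blocks, the quotient tensor averages the action of
  \<open>T\<close> over a block. Hence such an eigenvector passes to the quotient with the same
  eigenvalue.\<close>

lemma tensor_apply_quotient_tensor:
  assumes "finite (\<Union>P)"
    and disj: "\<And>A B j. A \<in> P \<Longrightarrow> B \<in> P \<Longrightarrow> j \<in> A \<Longrightarrow> j \<in> B \<Longrightarrow> A = B"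
    and const: "\<And>A j. A \<in> P \<Longrightarrow> j \<in> A \<Longrightarrow> x j = y A"
  shows "tensor_apply k P (quotient_tensor T) y A =
    1 / real (card A) * (\<Sum>j\<in>A. tensor_apply k (\<Union>P) T x j)"
proof -
  have eq: "prod_list (map y As) = prod_list (map x js)" if "set As \<subseteq> P" "js \<in> listset As" for As js
  proof -
    have "list_all2 (\<in>) js As" using that by (simp add: in_listset_iff)
    hence "map y As = map x js" using that(1)
      by (induction rule: list_all2_induct) (auto simp: const)
    thus ?thesis by simp
  qed
  have "tensor_apply k P (quotient_tensor T) y A =
    (\<Sum>As | set As \<subseteq> P \<and> length As = k - 1. 1 / real (card A) *
      (\<Sum>j\<in>A. \<Sum>js\<in>listset As. T (j # js) * prod_list (map x js)))"
    unfolding tensor_apply_def quotient_tensor_def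
    by (intro sum.cong refl) (auto simp: sum_distrib_right sum_distrib_left mult.assoc eq)
  also have "\<dots> = 1 / real (card A) * (\<Sum>j\<in>A. \<Sum>As | set As \<subseteq> P \<and> length As = k - 1.
      \<Sum>js\<in>listset As. T (j # js) * prod_list (map x js))"
    unfolding sum_distrib_left[symmetric] by (subst sum.swap) simp
  also have "\<dots> = 1 / real (card A) * (\<Sum>j\<in>A. tensor_apply k (\<Union>P) T x j)"
    unfolding tensor_apply_def by (subst sum_listset_partition[OF assms(1) disj]) auto
  finally show ?thesis .
qed

section \<open>The signless Laplacian tensor of a uniform hypergraph\<close>

text \<open>The degree part survives only at the constant list. In the adjacency part an edge
  \<open>e\<close> through \<open>i\<close> is hit by the \<open>(k - 1)!\<close> orderings of
  \<open>e - {i}\<close>, which cancels the factor in the tensor.\<close>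

lemma tensor_apply_signless_laplacian:
  assumes fin: "finite N" "i \<in> N"
    and H: "\<And>e. e \<in> H \<Longrightarrow> e \<subseteq> N \<and> card e = k"
  shows "tensor_apply k N (signless_laplacian_tensor k H) x i =
    real (hyper_degree H i) * x i ^ (k - 1) + (\<Sum>e | e \<in> H \<and> i \<in> e. prod x (e - {i}))"
proof -
  let ?L = "{is. set is \<subseteq> N \<and> length is = k - 1}"
  have finL: "finite ?L" by (rule finite_lists_length_eq[OF fin(1)])
  have finH: "finite H" using H fin by (intro finite_subset[of H "Pow N"]) auto
  have "(\<Sum>is\<in>?L. degree_tensor H (i # is) * prod_list (map x is)) =
    (\<Sum>is\<in>{replicate (k - 1) i}. degree_tensor H (i # is) * prod_list (map x is))"
  proof (rule sum.mono_neutral_right[OF finL])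
    show "{replicate (k - 1) i} \<subseteq> ?L" using fin(2) by auto
    show "\<forall>is\<in>?L - {replicate (k - 1) i}. degree_tensor H (i # is) * prod_list (map x is) = 0"
    proof
      fix "is" assume h: "is \<in> ?L - {replicate (k - 1) i}"
      hence "\<not> set is \<subseteq> {i}" using replicate_eqI[of "is" "k - 1" i] by auto
      thus "degree_tensor H (i # is) * prod_list (map x is) = 0" by (auto simp: degree_tensor_def)
    qed
  qed
  also have "\<dots> = real (hyper_degree H i) * x i ^ (k - 1)"
    by (auto simp: degree_tensor_def)
  finally have deg: "(\<Sum>is\<in>?L. degree_tensor H (i # is) * prod_list (map x is)) =
    real (hyper_degree H i) * x i ^ (k - 1)" .
  let ?Hi = "{e. e \<in> H \<and> i \<in> e}"
  have perm: "{is \<in> ?L. set (i # is) = e} = permutations_of_set (e - {i})" if "e \<in> ?Hi" for e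
  proof (intro equalityI subsetI)
    fix "is" assume h: "is \<in> {is \<in> ?L. set (i # is) = e}"
    have ce: "card e = k" "finite e" "e \<noteq> {}" using H[of e] that fin by (auto intro: finite_subset)
    hence "k > 0" by auto
    \<comment> \<open>The list has \<open>k\<close> entries and fills a set of \<open>k\<close>
      elements, so nothing repeats.\<close>
    hence "distinct (i # is)" using h ce by (intro card_distinct) auto
    thus "is \<in> permutations_of_set (e - {i})" using h by (auto simp: permutations_of_set_def)
  next
    fix "is" assume h: "is \<in> permutations_of_set (e - {i})"
    have "card (e - {i}) = k - 1" using H[of e] that by simp
    with h have "length is = k - 1" by (simp add: length_finite_permutations_of_set)
    thus "is \<in> {is \<in> ?L. set (i # is) = e}"
      using h that H[of e] by (auto dest: permutations_of_setD)
  qed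
  have "(\<Sum>is\<in>?L. adjacency_tensor k H (i # is) * prod_list (map x is)) =
    (\<Sum>is\<in>{is\<in>?L. set (i # is) \<in> ?Hi}. prod_list (map x is) / fact (k - 1))"
    by (rule sum.mono_neutral_cong_right[OF finL]) (auto simp: adjacency_tensor_def)
  also have "\<dots> = (\<Sum>e\<in>?Hi. \<Sum>is | is \<in> {is\<in>?L. set (i # is) \<in> ?Hi} \<and> set (i # is) = e.
      prod_list (map x is) / fact (k - 1))"
    using finL finH by (intro sum.group[symmetric] finite_subset[OF _ finL]) auto
  also have "\<dots> = (\<Sum>e\<in>?Hi. prod x (e - {i}))"
  proof (intro sum.cong refl)
    fix e assume e: "e \<in> ?Hi"
    have "{is. is \<in> {is\<in>?L. set (i # is) \<in> ?Hi} \<and> set (i # is) = e} = permutations_of_set (e - {i})"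
      using e unfolding perm[OF e, symmetric] by auto
    moreover have "prod_list (map x is) = prod x (e - {i})" if "is \<in> permutations_of_set (e - {i})" for "is"
      using permutations_of_setD[OF that] by (simp add: prod.distinct_set_conv_list[symmetric])
    moreover have "card (e - {i}) = k - 1" using H[of e] e by simp
    moreover have "finite (e - {i})" using H[of e] e fin by (auto intro: finite_subset)
    ultimately show "(\<Sum>is | is \<in> {is\<in>?L. set (i # is) \<in> ?Hi} \<and> set (i # is) = e.
      prod_list (map x is) / fact (k - 1)) = prod x (e - {i})"
      by simp
  qed
  finally show ?thesis using deg
    unfolding tensor_apply_def signless_laplacian_tensor_def
    by (simp add: distrib_right sum.distrib)
qed

section \<open>Generalized power hypergraphs\<close>

text \<open>The hyperedge as a function of the set \<open>e\<close> instead of its two endpoints;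
  this turns sums over hyperedges into sums over \<open>E\<close>.\<close>

definition gp_edge :: "nat \<Rightarrow> nat \<Rightarrow> 'a set \<Rightarrow> 'a gp_vertex set" where
  "gp_edge k s e = (\<Union>v\<in>e. gp_vblock s v) \<union> gp_eblock k s e"

lemma VCopy_in_gp_edge_iff: "VCopy v i \<in> gp_edge k s e \<longleftrightarrow> v \<in> e \<and> i < s"
  by (auto simp: gp_edge_def gp_vblock_def gp_eblock_def)

lemma ECopy_in_gp_edge_iff: "ECopy e' i \<in> gp_edge k s e \<longleftrightarrow> e' = e \<and> i < k - 2 * s"
  by (auto simp: gp_edge_def gp_vblock_def gp_eblock_def)

lemma gp_edges_eq:
  assumes "simple_graph V E"
  shows "gp_edges E k s = gp_edge k s ` E"
proof -
  have "\<exists>u v. e = {u, v}" if "e \<in> E" for e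
    using assms that unfolding simple_graph_def card_2_iff by blast
  hence "{{u, v} | u v. {u, v} \<in> E} = E" by fastforce
  hence "gp_edge k s ` E = gp_edge k s ` {{u, v} | u v. {u, v} \<in> E}" by simp
  also have "\<dots> = {gp_edge k s {u, v} | u v. {u, v} \<in> E}" by blast
  finally show ?thesis by (simp add: gp_edges_def gp_edge_def)
qed

text \<open>The edge is recovered from the copies with index 0 of its endpoints, which exist because
  \<open>s \<ge> 1\<close>.\<close>

lemma inj_gp_edge:
  assumes "s \<ge> 1"
  shows "inj (gp_edge k s)"
proof (rule injI)
  fix e e' :: "'a set" assume "gp_edge k s e = gp_edge k s e'"
  hence "v \<in> e \<longleftrightarrow> v \<in> e'" for v
    using VCopy_in_gp_edge_iff[of v 0 k s e] VCopy_in_gp_edge_iff[of v 0 k s e'] assms by simp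
  thus "e = e'" by blast
qed

lemma prod_gp_edge:
  assumes "finite e"
  shows "prod f (gp_edge k s e) = (\<Prod>v\<in>e. \<Prod>i<s. f (VCopy v i)) * (\<Prod>i<k - 2 * s. f (ECopy e i))"
proof -
  have "prod f (gp_edge k s e) = prod f (\<Union>v\<in>e. gp_vblock s v) * prod f (gp_eblock k s e)"
    unfolding gp_edge_def using assms
    by (intro prod.union_disjoint) (auto simp: gp_vblock_def gp_eblock_def)
  also have "prod f (\<Union>v\<in>e. gp_vblock s v) = (\<Prod>v\<in>e. prod f (gp_vblock s v))"
    using assms by (intro prod.UNION_disjoint) (auto simp: gp_vblock_def)
  finally show ?thesis
    by (simp add: gp_vblock_def gp_eblock_def prod.reindex inj_on_def)
qed

lemma card_gp_edge:
  assumes "card e = 2" "2 * s \<le> k"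
  shows "card (gp_edge k s e) = k"
proof -
  have fin: "finite e" using assms(1) by (intro card_ge_0_finite) simp
  have "card (gp_edge k s e) = card (\<Union>v\<in>e. gp_vblock s v) + card (gp_eblock k s e)"
    unfolding gp_edge_def using fin
    by (intro card_Un_disjoint) (auto simp: gp_vblock_def gp_eblock_def)
  also have "card (\<Union>v\<in>e. gp_vblock s v) = (\<Sum>v\<in>e. card (gp_vblock s v))"
    using fin by (intro card_UN_disjoint) (auto simp: gp_vblock_def)
  finally show ?thesis using assms
    by (simp add: gp_vblock_def gp_eblock_def card_image inj_on_def)
qed

lemma finite_gp_verts: "simple_graph V E \<Longrightarrow> finite (gp_verts V E k s)"
  using simple_graph_finite_edges[of V E]
  by (auto simp: gp_verts_def gp_vblock_def gp_eblock_def simple_graph_def)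

text \<open>Dividing by the nonzero \<open>X j\<close> replaces the product over an edge without
  \<open>j\<close> by the product over the whole edge, a quantity common to all its
  vertices.\<close>

lemma tensor_apply_gp_Q:
  assumes G: "simple_graph V E" and s: "s \<ge> 1" "2 * s \<le> k"
    and j: "j \<in> gp_verts V E k s" "X j \<noteq> 0"
  shows "tensor_apply k (gp_verts V E k s) (gp_Q E k s) X j =
    real (card {e \<in> E. j \<in> gp_edge k s e}) * X j ^ (k - 1) +
    (\<Sum>e | e \<in> E \<and> j \<in> gp_edge k s e. prod X (gp_edge k s e)) / X j"
proof -
  have inj: "inj_on (gp_edge k s) A" for A :: "'a set set"
    using inj_gp_edge[OF s(1)] by (rule inj_on_subset) simp
  have sub: "e \<subseteq> gp_verts V E k s \<and> card e = k" if "e \<in> gp_edges E k s" for e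
    using that G card_gp_edge[OF _ s(2)]
    by (fastforce simp: gp_edges_eq[OF G] simple_graph_def gp_verts_def gp_edge_def)
  have eq: "{e. e \<in> gp_edges E k s \<and> j \<in> e} = gp_edge k s ` {e \<in> E. j \<in> gp_edge k s e}"
    by (auto simp: gp_edges_eq[OF G])
  have "prod X (gp_edge k s e - {j}) = prod X (gp_edge k s e) / X j"
    if "e \<in> E" "j \<in> gp_edge k s e" for e
  proof -
    have "gp_edge k s e \<in> gp_edges E k s" using that by (simp add: gp_edges_eq[OF G])
    hence "finite (gp_edge k s e)" using sub finite_gp_verts[OF G] by (meson finite_subset)
    thus ?thesis using that j(2) by (simp add: prod_diff1)
  qed
  hence "(\<Sum>e\<in>{e \<in> E. j \<in> gp_edge k s e}. prod X (gp_edge k s e - {j})) =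
    (\<Sum>e | e \<in> E \<and> j \<in> gp_edge k s e. prod X (gp_edge k s e)) / X j"
    unfolding sum_divide_distrib by (intro sum.cong) auto
  moreover have "hyper_degree (gp_edges E k s) j = card {e \<in> E. j \<in> gp_edge k s e}"
    unfolding hyper_degree_def eq by (rule card_image[OF inj])
  moreover have "tensor_apply k (gp_verts V E k s) (gp_Q E k s) X j =
    real (hyper_degree (gp_edges E k s) j) * X j ^ (k - 1) +
    (\<Sum>e | e \<in> gp_edges E k s \<and> j \<in> e. prod X (e - {j}))"
    unfolding gp_Q_def using finite_gp_verts[OF G] j(1) sub
    by (rule tensor_apply_signless_laplacian)
  ultimately show ?thesis
    unfolding eq by (simp add: sum.reindex[OF inj])
qed

section \<open>The eigenvector on the power hypergraph\<close>

text \<open>The value at \<open>ECopy e i\<close> is the one forced by the eigenvalue equation at that vertex.\<close>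

fun gp_vec :: "nat \<Rightarrow> nat \<Rightarrow> real \<Rightarrow> ('a \<Rightarrow> real) \<Rightarrow> 'a gp_vertex \<Rightarrow> real" where
  "gp_vec k s \<rho> w (VCopy v i) = w v powr (2 / k)"
| "gp_vec k s \<rho> w (ECopy e i) =
     (\<Prod>v\<in>e. w v powr (2 / k)) powr (1 / 2) * (\<rho> - 1) powr (- 1 / (2 * s))"

text \<open>Let \<open>p\<close> be the product of the two endpoint values,
  \<open>r = \<rho> - 1\<close> and \<open>z\<close> the value at the edge copies. The choice of
  \<open>z\<close> gives \<open>p ^ s = r * z ^ (2 * s)\<close>, so the product over the hyperedge
  is \<open>r * z ^ k\<close>; inserting \<open>z\<close> and
  \<open>p powr (k / 2) = prod w e\<close> gives the second form. As \<open>z\<close> does not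
  depend on \<open>i\<close>, both forms make sense also for \<open>k = 2 * s\<close>, when there
  are no edge copies.\<close>

lemma prod_gp_vec_edge:
  assumes s: "s \<ge> 1" "2 * s \<le> k" and \<rho>: "\<rho> > 1"
    and e: "finite e" "\<And>v. v \<in> e \<Longrightarrow> 0 < w v"
  shows "prod (gp_vec k s \<rho> w) (gp_edge k s e) = (\<rho> - 1) * gp_vec k s \<rho> w (ECopy e i) ^ k"
    and "prod (gp_vec k s \<rho> w) (gp_edge k s e) =
      (\<rho> - 1) powr - (real k / (2 * s) - 1) * prod w e"
proof -
  define p where "p = (\<Prod>v\<in>e. w v powr (2 / k))"
  define r where "r = \<rho> - 1"
  define z where "z = p powr (1 / 2) * r powr (- 1 / (2 * s))"
  have r: "r > 0" using \<rho> by (simp add: r_def)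
  have p: "p > 0" unfolding p_def using e(2) by (intro prod_pos) (auto simp: less_le)
  have W: "prod w e > 0" using e(2) by (intro prod_pos) auto
  have k: "k > 0" using s by simp
  have z: "z > 0" using p r by (simp add: z_def)
  have zp: "z ^ n = p powr (real n / 2) * r powr (- real n / (2 * s))" for n
    using p r by (simp add: z_def power_mult_distrib powr_power)
  have "z ^ (2 * s) = p ^ s * (1 / r)"
    using p r s by (simp add: zp powr_realpow powr_minus_divide)
  hence ps: "p ^ s = r * z ^ (2 * s)" using r by simp
  have "prod (gp_vec k s \<rho> w) (gp_edge k s e) = p ^ s * z ^ (k - 2 * s)"
    unfolding prod_gp_edge[OF e(1)]
    by (simp add: p_def z_def r_def prod_power_distrib)
  also have "\<dots> = r * (z ^ (2 * s) * z ^ (k - 2 * s))" by (simp add: ps)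
  also have "\<dots> = r * z ^ k" using s(2) by (simp add: power_add[symmetric])
  finally have *: "prod (gp_vec k s \<rho> w) (gp_edge k s e) = r * z ^ k" .
  thus "prod (gp_vec k s \<rho> w) (gp_edge k s e) = (\<rho> - 1) * gp_vec k s \<rho> w (ECopy e i) ^ k"
    by (simp add: z_def r_def p_def)
  have "p = prod w e powr (2 / k)"
    unfolding p_def by (rule prod_powr_distrib[symmetric])
  hence "p powr (real k / 2) = prod w e" using W k by (simp add: powr_powr)
  moreover have "r * r powr (- real k / (2 * s)) = r powr (- (real k / (2 * s) - 1))"
    using r powr_add[of r 1 "- real k / (2 * s)"] by simp
  ultimately show "prod (gp_vec k s \<rho> w) (gp_edge k s e) =
      (\<rho> - 1) powr - (real k / (2 * s) - 1) * prod w e"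
    unfolding * zp by (simp add: r_def mult_ac)
qed

text \<open>Row \<open>v\<close> of the linear system times \<open>w v\<close>, with neighbours
  \<open>u\<close> traded for incident edges \<open>{v, u}\<close>, to match the sums over edges in
  the tensor equation.\<close>

lemma weighted_Q_sum_edges:
  assumes G: "simple_graph V E" and v: "v \<in> V"
  shows "(\<Sum>u\<in>V. weighted_Q E c v u * w u) * w v =
    real (hyper_degree E v) * (w v)\<^sup>2 + (\<Sum>e | e \<in> E \<and> v \<in> e. c * prod w e)"
proof -
  have fin: "finite V" using G by (simp add: simple_graph_def)
  have "(\<Sum>u\<in>V. weighted_Q E c v u * w u) * w v =
    (\<Sum>u\<in>V. if v = u then real (hyper_degree E v) * (w v)\<^sup>2 else 0) +
    (\<Sum>u\<in>V. if {v, u} \<in> E then c * (w v * w u) else 0)"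
    unfolding sum_distrib_right sum.distrib[symmetric]
    by (intro sum.cong) (auto simp: weighted_Q_def power2_eq_square algebra_simps)
  also have "(\<Sum>u\<in>V. if v = u then real (hyper_degree E v) * (w v)\<^sup>2 else 0) =
    real (hyper_degree E v) * (w v)\<^sup>2"
    using fin v by simp
  also have "(\<Sum>u\<in>V. if {v, u} \<in> E then c * (w v * w u) else 0) =
    (\<Sum>u | u \<in> V \<and> {v, u} \<in> E. c * (w v * w u))"
    using fin by (simp add: sum.inter_filter)
  also have "\<dots> = (\<Sum>e | e \<in> E \<and> v \<in> e. c * prod w e)"
  proof -
    have "bij_betw (\<lambda>u. {v, u}) {u. u \<in> V \<and> {v, u} \<in> E} {e. e \<in> E \<and> v \<in> e}"
      unfolding bij_betw_def
    proof (intro conjI equalityI subsetI)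
      show "inj_on (\<lambda>u. {v, u}) {u. u \<in> V \<and> {v, u} \<in> E}"
        by (auto simp: inj_on_def doubleton_eq_iff)
      fix e assume e: "e \<in> {e. e \<in> E \<and> v \<in> e}"
      hence "e \<subseteq> V" "card e = 2" using G by (auto simp: simple_graph_def)
      with e obtain u where "e = {v, u}" by (auto simp: card_2_iff)
      with e \<open>e \<subseteq> V\<close> show "e \<in> (\<lambda>u. {v, u}) ` {u. u \<in> V \<and> {v, u} \<in> E}" by auto
    qed auto
    hence "(\<Sum>e | e \<in> E \<and> v \<in> e. c * prod w e) =
      (\<Sum>u | u \<in> V \<and> {v, u} \<in> E. c * prod w {v, u})"
      by (rule sum.reindex_bij_betw[symmetric])
    also have "\<dots> = (\<Sum>u | u \<in> V \<and> {v, u} \<in> E. c * (w v * w u))"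
      using simple_graph_edgeD(3)[OF G] by (intro sum.cong refl) auto
    finally show ?thesis by simp
  qed
  finally show ?thesis .
qed

lemma gp_vec_pos:
  assumes G: "simple_graph V E" and "\<rho> > 1" "\<And>v. v \<in> V \<Longrightarrow> 0 < w v"
    and "j \<in> gp_verts V E k s"
  shows "0 < gp_vec k s \<rho> w j"
proof (cases j)
  case (VCopy v i)
  hence "v \<in> V" using assms(4) by (auto simp: gp_verts_def gp_vblock_def gp_eblock_def)
  with assms(3)[of v] VCopy show ?thesis by simp
next
  case (ECopy e i)
  hence "e \<subseteq> V" using assms(4) G
    by (auto simp: gp_verts_def gp_vblock_def gp_eblock_def simple_graph_def)
  hence "0 < (\<Prod>v\<in>e. w v powr (2 / k))"
    using assms(3) by (intro prod_pos) (force simp: less_le)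
  with assms(2) ECopy show ?thesis by simp
qed

text \<open>Multiplied by \<open>X j\<close>, the equation at a copy of \<open>v\<close> is row
  \<open>v\<close> of the linear system times \<open>w v\<close>, since \<open>X j ^ k\<close> is
  the square of \<open>w v\<close>. An edge copy lies in a single hyperedge: its degree contributes
  1 to the eigenvalue and the hyperedge product contributes \<open>\<rho> - 1\<close>.\<close>

lemma gp_vec_eigenvector:
  assumes G: "simple_graph V E" and s: "s \<ge> 1" "2 * s \<le> k" and \<rho>: "\<rho> > 1"
    and w: "\<And>v. v \<in> V \<Longrightarrow> 0 < w v"
    and eig: "\<And>v. v \<in> V \<Longrightarrow>
      (\<Sum>u\<in>V. weighted_Q E ((\<rho> - 1) powr - (real k / (2 * s) - 1)) v u * w u) = \<rho> * w v"
    and j: "j \<in> gp_verts V E k s"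
  shows "tensor_apply k (gp_verts V E k s) (gp_Q E k s) (gp_vec k s \<rho> w) j =
    \<rho> * gp_vec k s \<rho> w j ^ (k - 1)"
proof -
  define c where "c = (\<rho> - 1) powr - (real k / (2 * s) - 1)"
  define X where "X = gp_vec k s \<rho> w"
  have X: "X j > 0" unfolding X_def using gp_vec_pos[OF G \<rho> w j] .
  have k: "k > 0" using s by simp
  have Xk: "X j ^ k / X j = X j ^ (k - 1)" using X k by (simp add: power_diff)
  have e: "finite e" "\<And>v. v \<in> e \<Longrightarrow> 0 < w v" if "e \<in> E" for e
    using that G w by (auto simp: simple_graph_def intro: finite_subset)
  have T: "tensor_apply k (gp_verts V E k s) (gp_Q E k s) X j =
    real (card {e \<in> E. j \<in> gp_edge k s e}) * X j ^ (k - 1) +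
    (\<Sum>e | e \<in> E \<and> j \<in> gp_edge k s e. prod X (gp_edge k s e)) / X j"
    using G s j X by (intro tensor_apply_gp_Q) auto
  have "tensor_apply k (gp_verts V E k s) (gp_Q E k s) X j = \<rho> * X j ^ (k - 1)"
  proof (cases j)
    case (VCopy v i)
    hence v: "v \<in> V" "i < s" using j by (auto simp: gp_verts_def gp_vblock_def gp_eblock_def)
    hence eq: "{e \<in> E. j \<in> gp_edge k s e} = {e \<in> E. v \<in> e}"
      by (simp add: VCopy VCopy_in_gp_edge_iff)
    have wX: "(w v)\<^sup>2 = X j ^ k"
      using w[OF v(1)] k by (simp add: VCopy X_def powr_power)
    have "(\<Sum>e | e \<in> E \<and> v \<in> e. prod X (gp_edge k s e)) = (\<Sum>e | e \<in> E \<and> v \<in> e. c * prod w e)"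
      unfolding X_def c_def using s \<rho> e by (intro sum.cong refl prod_gp_vec_edge(2)) auto
    also have "\<dots> = (\<Sum>u\<in>V. weighted_Q E c v u * w u) * w v - real (hyper_degree E v) * (w v)\<^sup>2"
      using weighted_Q_sum_edges[OF G v(1), of c w] by simp
    also have "\<dots> = (\<rho> - real (hyper_degree E v)) * X j ^ k"
      unfolding c_def eig[OF v(1)] wX[symmetric] by (simp add: power2_eq_square algebra_simps)
    finally have "(\<Sum>e | e \<in> E \<and> v \<in> e. prod X (gp_edge k s e)) / X j =
      (\<rho> - real (hyper_degree E v)) * X j ^ (k - 1)"
      by (simp add: Xk times_divide_eq_right[symmetric] del: times_divide_eq_right)
    thus ?thesis unfolding T eq by (simp add: hyper_degree_def algebra_simps)
  next
    case (ECopy e i)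
    hence ei: "e \<in> E" "i < k - 2 * s" using j by (auto simp: gp_verts_def gp_vblock_def gp_eblock_def)
    hence eq: "{e \<in> E. j \<in> gp_edge k s e} = {e}"
      by (auto simp: ECopy ECopy_in_gp_edge_iff)
    have "prod X (gp_edge k s e) = (\<rho> - 1) * X j ^ k"
      unfolding X_def ECopy using s \<rho> e[OF ei(1)] by (intro prod_gp_vec_edge(1)) auto
    hence "prod X (gp_edge k s e) / X j = (\<rho> - 1) * X j ^ (k - 1)"
      by (simp add: Xk times_divide_eq_right[symmetric] del: times_divide_eq_right)
    thus ?thesis unfolding T eq by (simp add: algebra_simps)
  qed
  thus ?thesis by (simp add: X_def)
qed

section \<open>Largest H-eigenvalues of both tensors\<close>

lemma signless_laplacian_tensor_nonneg: "0 \<le> signless_laplacian_tensor k H is"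
  by (simp add: signless_laplacian_tensor_def degree_tensor_def adjacency_tensor_def)

lemma Union_gp_partition: "\<Union>(gp_partition V E k s) = gp_verts V E k s"
  by (auto simp: gp_partition_def gp_verts_def)

lemma gp_partition_disjoint:
  assumes "A \<in> gp_partition V E k s" "B \<in> gp_partition V E k s" "j \<in> A" "j \<in> B"
  shows "A = B"
  using assms by (auto simp: gp_partition_def gp_vblock_def gp_eblock_def)

lemma gp_vec_constant_on_blocks:
  assumes "A \<in> gp_partition V E k s" "i \<in> A" "j \<in> A"
  shows "gp_vec k s \<rho> w i = gp_vec k s \<rho> w j"
  using assms by (auto simp: gp_partition_def gp_vblock_def gp_eblock_def)

text \<open>The vector \<open>gp_vec\<close> is a positive eigenvector of the first tensor, and its
  block values form one of the quotient tensor, with the same \<open>\<rho>\<close>; positivity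
  makes \<open>\<rho>\<close> the largest in both cases.\<close>

lemma gp_largest_H_eigenvalues:
  assumes G: "simple_graph V E" "V \<noteq> {}" and s: "s \<ge> 1" "2 * s \<le> k" and \<rho>: "\<rho> > 1"
    and w: "\<And>v. v \<in> V \<Longrightarrow> 0 < w v"
    and eig: "\<And>v. v \<in> V \<Longrightarrow>
      (\<Sum>u\<in>V. weighted_Q E ((\<rho> - 1) powr - (real k / (2 * s) - 1)) v u * w u) = \<rho> * w v"
  shows "is_largest_H_eigenvalue k (gp_verts V E k s) (gp_Q E k s) \<rho>"
    and "is_largest_H_eigenvalue k (gp_partition V E k s) (gp_B E k s) \<rho>"
proof -
  let ?N = "gp_verts V E k s" and ?P = "gp_partition V E k s"
  define X where "X = gp_vec k s \<rho> w"
  have X: "0 < X j" "tensor_apply k ?N (gp_Q E k s) X j = \<rho> * X j ^ (k - 1)" if "j \<in> ?N" for j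
    unfolding X_def using gp_vec_pos[OF G(1) \<rho> w that] gp_vec_eigenvector[OF G(1) s \<rho> w eig that]
    by auto
  have fin: "finite ?N" by (rule finite_gp_verts[OF G(1)])
  obtain v where "v \<in> V" using G(2) by auto
  hence "VCopy v 0 \<in> ?N" using s(1) by (fastforce simp: gp_verts_def gp_vblock_def)
  hence ne: "?N \<noteq> {}" by blast
  show "is_largest_H_eigenvalue k ?N (gp_Q E k s) \<rho>"
    using fin ne _ X unfolding gp_Q_def
    by (rule positive_eigenvector_imp_largest_H_eigenvalue) (rule signless_laplacian_tensor_nonneg)
  have finP: "finite (\<Union>?P)" unfolding Union_gp_partition by (rule fin)
  \<comment> \<open>Any representative will do, because \<open>X\<close> is constant on each
    block.\<close>
  define y where "y A = X (SOME j. j \<in> A)" for A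
  have y: "X j = y A" if "A \<in> ?P" "j \<in> A" for A j
    unfolding y_def X_def using that someI[of "\<lambda>j. j \<in> A" j]
    by (intro gp_vec_constant_on_blocks) auto
  \<comment> \<open>The average over a block divides by \<open>card A\<close>. The empty edge blocks
    arising for \<open>k = 2 * s\<close> have been removed from the partition.\<close>
  have block: "finite A" "A \<noteq> {}" "A \<subseteq> ?N" if "A \<in> ?P" for A
    using that finP Union_gp_partition[of V E k s]
    by (auto simp: gp_partition_def gp_eblock_def gp_vblock_def)
  have posy: "0 < y A" if "A \<in> ?P" for A
  proof -
    obtain j where "j \<in> A" using block[OF \<open>A \<in> ?P\<close>] by auto
    with X(1)[of j] y[OF that] block(3)[OF that] show ?thesis by auto
  qed
  have eigy: "tensor_apply k ?P (gp_B E k s) y A = \<rho> * y A ^ (k - 1)" if "A \<in> ?P" for A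
  proof -
    have "tensor_apply k ?P (gp_B E k s) y A =
      1 / real (card A) * (\<Sum>j\<in>A. tensor_apply k (\<Union>?P) (gp_Q E k s) X j)"
      unfolding gp_B_def by (rule tensor_apply_quotient_tensor[OF finP gp_partition_disjoint y])
    also have "(\<Sum>j\<in>A. tensor_apply k (\<Union>?P) (gp_Q E k s) X j) = (\<Sum>j\<in>A. \<rho> * y A ^ (k - 1))"
      unfolding Union_gp_partition using block(3)[OF that] X(2) y[OF that]
      by (intro sum.cong refl) auto
    finally show ?thesis using block[OF that] by simp
  qed
  have finP': "finite ?P" using finP by (rule finite_UnionD)
  have neP: "?P \<noteq> {}" using ne Union_gp_partition[of V E k s] by auto
  have nnB: "0 \<le> gp_B E k s is" for "is"
    by (auto simp: gp_B_def gp_Q_def quotient_tensor_def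
      intro!: sum_nonneg divide_nonneg_nonneg signless_laplacian_tensor_nonneg)
  show "is_largest_H_eigenvalue k ?P (gp_B E k s) \<rho>"
    using finP' neP nnB posy eigy by (rule positive_eigenvector_imp_largest_H_eigenvalue)
qed

theorem theorem4p7:
  fixes V :: "'a set" and E :: "'a set set" and k :: nat
  assumes "simple_graph V E"
    and "graph_connected V E"
    and "card V > 2"
    and "k > 2"
  shows "(\<forall>s. 1 \<le> s \<and> 2 * s \<le> k \<longrightarrow>
            (\<exists>l. is_largest_H_eigenvalue k (gp_partition V E k s) (gp_B E k s) l) \<and>
            (\<exists>l. is_largest_H_eigenvalue k (gp_verts V E k s) (gp_Q E k s) l) \<and>
            largest_H_eigenvalue k (gp_partition V E k s) (gp_B E k s) =
            largest_H_eigenvalue k (gp_verts V E k s) (gp_Q E k s)) \<and>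
         strict_mono_on {s. 1 \<le> s \<and> 2 * s \<le> k}
           (\<lambda>s. largest_H_eigenvalue k (gp_verts V E k s) (gp_Q E k s))"
proof -
  note G = assms(1-3)
  have V: "V \<noteq> {}" using G by auto
  define fixpt where "fixpt s \<rho> w \<longleftrightarrow> \<rho> > 2 \<and> (\<forall>v\<in>V. 0 < w v) \<and>
    (\<forall>v\<in>V. (\<Sum>u\<in>V. weighted_Q E ((\<rho> - 1) powr - (real k / (2 * s) - 1)) v u * w u) = \<rho> * w v)"
    for s :: nat and \<rho> :: real and w :: "'a \<Rightarrow> real"
  have ex: "\<exists>\<rho> w. fixpt s \<rho> w" if s: "1 \<le> s" "2 * s \<le> k" for s
  proof -
    have "real (2 * s) \<le> real k" using s(2) by (rule of_nat_mono)
    \<comment> \<open>The exponent vanishes for \<open>k = 2 * s\<close>; the linear system is then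
      that of the ordinary signless Laplacian D + A.\<close>
    hence "0 \<le> real k / (2 * s) - 1" using s(1) by (simp add: field_simps)
    thus ?thesis
    proof (rule weighted_Q_fixed_point[OF G])
      fix \<rho> w assume "\<rho> > 2" "\<And>v. v \<in> V \<Longrightarrow> 0 < w v"
        "\<And>v. v \<in> V \<Longrightarrow>
          (\<Sum>u\<in>V. weighted_Q E ((\<rho> - 1) powr - (real k / (2 * s) - 1)) v u * w u) = \<rho> * w v"
      hence "fixpt s \<rho> w" unfolding fixpt_def by blast
      thus ?thesis by blast
    qed
  qed
  have largest: "is_largest_H_eigenvalue k (gp_verts V E k s) (gp_Q E k s) \<rho>"
    "is_largest_H_eigenvalue k (gp_partition V E k s) (gp_B E k s) \<rho>"
    if "1 \<le> s" "2 * s \<le> k" "fixpt s \<rho> w" for s \<rho> w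
    using gp_largest_H_eigenvalues[OF G(1) V that(1,2), of \<rho> w] that(3)
    unfolding fixpt_def by auto
  show ?thesis
  proof (intro conjI allI impI strict_mono_onI; clarify?)
    fix s assume s: "1 \<le> s" "2 * s \<le> k"
    obtain \<rho> w where f: "fixpt s \<rho> w" using ex[OF s] by blast
    note l = largest[OF s f]
    show "\<exists>l. is_largest_H_eigenvalue k (gp_partition V E k s) (gp_B E k s) l"
      "\<exists>l. is_largest_H_eigenvalue k (gp_verts V E k s) (gp_Q E k s) l"
      using l by blast+
    show "largest_H_eigenvalue k (gp_partition V E k s) (gp_B E k s) =
      largest_H_eigenvalue k (gp_verts V E k s) (gp_Q E k s)"
      using l by (simp add: largest_H_eigenvalue_eqI)
  next
    fix s t assume s: "1 \<le> s" "2 * s \<le> k" and t: "1 \<le> t" "2 * t \<le> k" and st: "s < (t::nat)"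
    obtain \<rho> w where f: "fixpt s \<rho> w" using ex[OF s] by blast
    obtain \<sigma> y where g: "fixpt t \<sigma> y" using ex[OF t] by blast
    have "real (2 * t) \<le> real k" using t(2) by (rule of_nat_mono)
    hence t0: "0 \<le> real k / (2 * t) - 1" using t(1) by (simp add: field_simps)
    \<comment> \<open>A larger number of vertex copies means a smaller exponent, so \<open>s\<close>
      supplies \<open>a\<close> and \<open>t\<close> supplies \<open>b\<close> in the
      comparison.\<close>
    have "real k / (2 * t) - 1 < real k / (2 * s) - 1"
      using st s(1) assms(4) by (simp add: divide_strict_left_mono)
    from weighted_Q_fixed_point_strict_antimono[OF G this t0, of \<rho> w \<sigma> y] have "\<rho> < \<sigma>"
      using f g unfolding fixpt_def by blast
    thus "largest_H_eigenvalue k (gp_verts V E k s) (gp_Q E k s)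
      < largest_H_eigenvalue k (gp_verts V E k t) (gp_Q E k t)"
      using largest_H_eigenvalue_eqI[OF largest(1)[OF s f]]
        largest_H_eigenvalue_eqI[OF largest(1)[OF t g]] by simp
  qed
qed

end
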